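(* Let $A\in\mathbb{R}^{m\times n}$ and $b\in\mathbb{R}^m$ be such that the linear system $Ax=b$ is consistent, let $\ell$ be a positive integer, and let $x^0\in\operatorname{Range}(A^\top)$. Let $\{S_k\}_{k\ge 0}\subset\mathbb{R}^{m\times q}$ be matrices and let $\{x^k\}_{k\ge1}$ be defined recursively by $$x^{k+1}=\arg\min_{x\in\Pi_k}\|x-A^\dagger b\|_2^2,\qquad \Pi_k=\operatorname{aff}\{x^{j_k},\ldots,x^k,\;x^k-A^\top S_kS_k^\top(Ax^k-b)\},$$ where $j_k=\max\{k-\ell+1,0\}$. Define $$M_k=\big(x^{j_k}-x^k,\ \ldots,\ x^{k-1}-x^k,\ -A^\top S_kS_k^\top(Ax^k-b)\big)\in\mathbb{R}^{n\times(k-j_k+1)}$$ (when $j_k=k$, $M_k$ consists only of its last column). If $S_i^\top(Ax^i-b)\neq 0$ for $i=0,\ldots,k$, then $M_k$ has full column rank.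
   Context: $A^\dagger$ denotes the Moore–Penrose pseudoinverse of $A$. For vectors $y^1,\dots,y^p$, $\operatorname{aff}\{y^1,\dots,y^p\}=\{\sum_i\alpha_iy^i:\sum_i\alpha_i=1,\ \alpha_i\in\mathbb{R}\}$ is their affine hull. The minimizer of the strictly convex function $\|x-A^\dagger b\|_2^2$ over the affine set $\Pi_k$ is the orthogonal projection of $A^\dagger b$ onto $\Pi_k$. *)

theory Defs
  imports "HOL-Analysis.Analysis"
begin

text \<open>Moore--Penrose pseudoinverse: the unique matrix satisfying the four Penrose conditions.\<close>
definition pinv :: "real^'n^'m \<Rightarrow> real^'m^'n" where
  "pinv A = (THE X. A ** X ** A = A \<and> X ** A ** X = X \<and>
                    transpose (A ** X) = A ** X \<and> transpose (X ** A) = X ** A)"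

text \<open>j_k = max{k - l + 1, 0} (computed in the integers, then returned as a nat).\<close>
definition jidx :: "nat \<Rightarrow> nat \<Rightarrow> nat" where
  "jidx l k = nat (max (int k - int l + 1) 0)"

text \<open>The sketched-residual direction  A^T S_k S_k^T (A x^k - b).\<close>
definition sdir :: "real^'n^'m \<Rightarrow> real^'m \<Rightarrow> real^'q^'m \<Rightarrow> real^'n \<Rightarrow> real^'n" where
  "sdir A b S xk = transpose A *v ((S ** transpose S) *v (A *v xk - b))"

text \<open>Pi_k = aff{x^{j_k},...,x^k, x^k - A^T S_k S_k^T (A x^k - b)}.\<close>
definition Pi_set :: "real^'n^'m \<Rightarrow> real^'m \<Rightarrow> (nat \<Rightarrow> real^'q^'m) \<Rightarrow> nat \<Rightarrow>
                      (nat \<Rightarrow> real^'n) \<Rightarrow> nat \<Rightarrow> (real^'n) set" where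
  "Pi_set A b S l x k = affine hull
     ((x ` {jidx l k..k}) \<union> {x k - sdir A b (S k) (x k)})"

text \<open>The columns of M_k, in order, as a list of vectors in R^n
  (k - j_k + 1 columns).\<close>
definition Mcols :: "real^'n^'m \<Rightarrow> real^'m \<Rightarrow> (nat \<Rightarrow> real^'q^'m) \<Rightarrow> nat \<Rightarrow>
                      (nat \<Rightarrow> real^'n) \<Rightarrow> nat \<Rightarrow> (real^'n) list" where
  "Mcols A b S l x k = map (\<lambda>j. x j - x k) [jidx l k..<k] @ [- sdir A b (S k) (x k)]"

text \<open>A matrix given by its list of columns has full column rank iff its rank
  (dimension of the column space) equals the number of columns.\<close>
definition full_col_rank :: "(real^'n) list \<Rightarrow> bool" where
  "full_col_rank cols \<longleftrightarrow> dim (span (set cols)) = length cols"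

end

theory Submission
  imports Defs
begin

(* Write c = A^+ b; consistency gives A c = b, the only property of the pseudoinverse that is
   used. Each x^(i+1) is the orthogonal projection of c onto the affine set Pi_i, so x^(i+1) - c
   is orthogonal to every difference of two points of Pi_i. Since Pi_(p-1) contains x^j for
   j_k <= j <= p, this gives <x^j - x^p, x^p - c> = 0 for j_k <= j <= p <= k, whereas
   <A^T S_i S_i^T (A x^i - b), x^i - c> = |S_i^T (A x^i - b)|^2 > 0, which also forces
   x^(i+1) ~= x^i. The columns x^j - x^k span the same space as the consecutive differences
   x^j - x^(j+1). Appending these in order, the new vector x^p - x^(p+1) has inner product
   |x^p - x^(p+1)|^2 ~= 0 with x^p - c while all earlier ones are orthogonal to it, so the rank
   grows by one at each step; the last column of M_k is appended in the same way, against
   x^k - c. *)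

section \<open>The Moore-Penrose inverse\<close>

(* Otherwise simp turns transpose A *v u into u v* A. *)
declare transpose_matrix_vector [simp del]

lemma subspace_range_matrix: "subspace (range ((*v) M))"
  for M :: "real^'n^'m"
  by (rule linear_subspace_image[OF matrix_vector_mul_linear subspace_UNIV])

lemma inner_transpose_mult: "inner (transpose A *v u) w = inner u (A *v w)"
  for A :: "real^'n^'m"
  by (simp add: transpose_matrix_vector dot_lmul_matrix)

lemma inner_mult_transpose: "inner (A *v v) w = inner v (transpose A *v w)"
  for A :: "real^'n^'m"
  using inner_transpose_mult[of "transpose A"] by simp

lemma mult_eq_0_if_gram_mult_eq_0:
  fixes A :: "real^'n^'m"
  assumes "transpose A *v (A *v v) = 0"
  shows "A *v v = 0"
proof -
  have "inner (A *v v) (A *v v) = 0"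
    using assms by (simp add: inner_mult_transpose)
  then show ?thesis by simp
qed

lemma range_orthogonal_decomposition:
  fixes M :: "real^'n^'m"
  obtains v w where "y = M *v v + w" and "transpose M *v w = 0"
proof -
  have range_span: "span (range ((*v) M)) = range ((*v) M)"
    by (simp add: span_eq_iff subspace_range_matrix)
  obtain y1 w where y1: "y1 \<in> range ((*v) M)" and y: "y = y1 + w"
    and w: "\<And>z. z \<in> range ((*v) M) \<Longrightarrow> orthogonal w z"
    using orthogonal_subspace_decomp_exists[of "range ((*v) M)" y] unfolding range_span by blast
  obtain v where v: "y1 = M *v v"
    using y1 by blast
  have "inner (transpose M *v w) (transpose M *v w) = 0"
    using w[of "M *v (transpose M *v w)"] by (simp add: inner_transpose_mult orthogonal_def)
  then show ?thesis
    by (intro that[of v w]) (simp_all add: y v)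
qed

lemma row_space_normal_equation_solvable:
  fixes A :: "real^'n^'m"
  shows "\<exists>x \<in> range ((*v) (transpose A)). transpose A *v (A *v x) = transpose A *v y"
proof -
  obtain v w where y: "y = A *v v + w" and w: "transpose A *v w = 0"
    by (rule range_orthogonal_decomposition)
  obtain u z where v: "v = transpose A *v u + z" and z: "A *v z = 0"
    using range_orthogonal_decomposition[of v "transpose A"] by auto
  have "transpose A *v (A *v (transpose A *v u)) = transpose A *v y"
    by (simp add: y v z w matrix_vector_right_distrib)
  then show ?thesis by blast
qed

lemma row_space_normal_equation_unique:
  fixes A :: "real^'n^'m"
  assumes "x \<in> range ((*v) (transpose A))" and "x' \<in> range ((*v) (transpose A))"
    and "transpose A *v (A *v x) = transpose A *v (A *v x')"
  shows "x = x'"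
proof -
  obtain u where "x = transpose A *v u"
    using assms(1) by (rule rangeE)
  moreover obtain u' where "x' = transpose A *v u'"
    using assms(2) by (rule rangeE)
  ultimately have u: "x - x' = transpose A *v (u - u')"
    by (simp add: matrix_vector_mult_diff_distrib)
  have "transpose A *v (A *v (x - x')) = 0"
    using assms(3) by (simp add: matrix_vector_mult_diff_distrib)
  then have null: "A *v (x - x') = 0"
    by (rule mult_eq_0_if_gram_mult_eq_0)
  have "inner (x - x') (x - x') = inner (transpose A *v (u - u')) (x - x')"
    by (simp only: u)
  also have "\<dots> = 0"
    by (simp add: inner_transpose_mult null)
  finally show ?thesis by simp
qed

(* Since pinv is a definite description, the Moore-Penrose inverse has to be shown to exist:
   A^+ y is the least-squares solution of A x = y lying in the row space of A. *)
definition min_norm_lsq :: "real^'n^'m \<Rightarrow> real^'m \<Rightarrow> real^'n" where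
  "min_norm_lsq A y =
     (THE x. x \<in> range ((*v) (transpose A)) \<and> transpose A *v (A *v x) = transpose A *v y)"

lemma min_norm_lsq:
  "min_norm_lsq A y \<in> range ((*v) (transpose A)) \<and>
   transpose A *v (A *v min_norm_lsq A y) = transpose A *v y"
  unfolding min_norm_lsq_def
proof (rule theI', rule ex_ex1I)
  show "\<exists>x. x \<in> range ((*v) (transpose A)) \<and> transpose A *v (A *v x) = transpose A *v y"
    using row_space_normal_equation_solvable by blast
qed (auto intro: row_space_normal_equation_unique)

lemma min_norm_lsq_eqI:
  assumes "x \<in> range ((*v) (transpose A))" and "transpose A *v (A *v x) = transpose A *v y"
  shows "min_norm_lsq A y = x"
  using min_norm_lsq[of A y] assms by (auto intro: row_space_normal_equation_unique)

lemma linear_min_norm_lsq: "linear (min_norm_lsq A)"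
proof
  fix y z and r :: real
  show "min_norm_lsq A (y + z) = min_norm_lsq A y + min_norm_lsq A z"
    using min_norm_lsq[of A y] min_norm_lsq[of A z]
    by (intro min_norm_lsq_eqI)
      (auto simp: matrix_vector_right_distrib intro: subspace_add[OF subspace_range_matrix])
  show "min_norm_lsq A (r *\<^sub>R y) = r *\<^sub>R min_norm_lsq A y"
    using min_norm_lsq[of A y]
    by (intro min_norm_lsq_eqI)
      (auto simp: matrix_vector_mult_scaleR intro: subspace_scale[OF subspace_range_matrix])
qed

lemma mult_min_norm_lsq_mult: "A *v min_norm_lsq A (A *v v) = A *v v"
  for A :: "real^'n^'m"
proof -
  have "transpose A *v (A *v (min_norm_lsq A (A *v v) - v)) = 0"
    using min_norm_lsq[of A "A *v v"] by (simp add: matrix_vector_mult_diff_distrib)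
  then have "A *v (min_norm_lsq A (A *v v) - v) = 0"
    by (rule mult_eq_0_if_gram_mult_eq_0)
  then show ?thesis
    by (simp add: matrix_vector_mult_diff_distrib)
qed

lemma transpose_eq_if_self_adjoint:
  fixes M :: "real^'n^'n"
  assumes "\<And>y z. inner (M *v y) z = inner y (M *v z)"
  shows "transpose M = M"
proof -
  have "transpose M *v y = M *v y" for y
    using assms by (metis inner_transpose_mult inner_commute vector_eq_rdot)
  then show ?thesis
    by (simp add: matrix_eq)
qed

definition moore_penrose :: "real^'n^'m \<Rightarrow> real^'m^'n \<Rightarrow> bool" where
  "moore_penrose A X \<longleftrightarrow> A ** X ** A = A \<and> X ** A ** X = X \<and>
     transpose (A ** X) = A ** X \<and> transpose (X ** A) = X ** A"

lemma moore_penrose_min_norm_lsq: "moore_penrose A (matrix (min_norm_lsq A))"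
  for A :: "real^'n^'m"
proof -
  define X where "X = matrix (min_norm_lsq A)"
  have X: "X *v y = min_norm_lsq A y" for y
    unfolding X_def by (metis matrix_vector_mul(2)[OF linear_min_norm_lsq])
  have "A ** X ** A = A"
    by (simp add: matrix_eq X mult_min_norm_lsq_mult flip: matrix_vector_mul_assoc)
  moreover have "X ** A ** X = X"
  proof -
    have "min_norm_lsq A (A *v min_norm_lsq A y) = min_norm_lsq A y" for y
      using min_norm_lsq[of A y] by (intro min_norm_lsq_eqI) auto
    then show ?thesis
      by (simp add: matrix_eq X flip: matrix_vector_mul_assoc)
  qed
  moreover have "transpose (A ** X) = A ** X"
  proof (rule transpose_eq_if_self_adjoint)
    have "inner (A *v min_norm_lsq A y) (z - A *v min_norm_lsq A z) = 0" for y z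
      using min_norm_lsq[of A z]
      by (simp add: inner_mult_transpose matrix_vector_mult_diff_distrib)
    then have "inner (A *v min_norm_lsq A y) z = inner (A *v min_norm_lsq A y) (A *v min_norm_lsq A z)"
      for y z
      by (simp add: inner_diff_right)
    then show "inner ((A ** X) *v y) z = inner y ((A ** X) *v z)" for y z
      by (metis X inner_commute matrix_vector_mul_assoc)
  qed
  moreover have "transpose (X ** A) = X ** A"
  proof (rule transpose_eq_if_self_adjoint)
    have "inner (min_norm_lsq A (A *v v)) (w - min_norm_lsq A (A *v w)) = 0" for v w
    proof -
      obtain u where u: "min_norm_lsq A (A *v v) = transpose A *v u"
        using min_norm_lsq[of A "A *v v"] by blast
      show ?thesis
        by (simp add: u inner_transpose_mult mult_min_norm_lsq_mult matrix_vector_mult_diff_distrib)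
    qed
    then have "inner (min_norm_lsq A (A *v v)) w =
        inner (min_norm_lsq A (A *v v)) (min_norm_lsq A (A *v w))" for v w
      by (simp add: inner_diff_right)
    then show "inner ((X ** A) *v v) w = inner v ((X ** A) *v w)" for v w
      by (metis X inner_commute matrix_vector_mul_assoc)
  qed
  ultimately show ?thesis
    unfolding moore_penrose_def X_def by blast
qed

lemma moore_penrose_unique:
  fixes A :: "real^'n^'m"
  assumes "moore_penrose A X" and "moore_penrose A Y"
  shows "X = Y"
proof -
  from assms have X1: "A ** X ** A = A" and X2: "X ** A ** X = X"
    and X3: "transpose (A ** X) = A ** X" and X4: "transpose (X ** A) = X ** A"
    and Y1: "A ** Y ** A = A" and Y2: "Y ** A ** Y = Y"
    and Y3: "transpose (A ** Y) = A ** Y" and Y4: "transpose (Y ** A) = Y ** A"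
    unfolding moore_penrose_def by auto
  have At_Y: "transpose A = transpose A ** A ** Y"
    by (metis Y1 Y3 matrix_transpose_mul matrix_mul_assoc)
  have At_X: "transpose A = X ** A ** transpose A"
    by (metis X1 X4 matrix_transpose_mul matrix_mul_assoc)
  have "X = X ** transpose X ** transpose A"
    by (metis X2 X3 matrix_transpose_mul matrix_mul_assoc)
  also have "\<dots> = X ** transpose (A ** X) ** A ** Y"
    by (metis At_Y matrix_transpose_mul matrix_mul_assoc)
  also have "\<dots> = X ** A ** Y"
    by (metis X2 X3 matrix_mul_assoc)
  finally have "X = X ** A ** Y" .
  have "Y = transpose A ** transpose Y ** Y"
    by (metis Y2 Y4 matrix_transpose_mul)
  also have "\<dots> = X ** A ** transpose (Y ** A) ** Y"
    by (metis At_X matrix_transpose_mul matrix_mul_assoc)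
  also have "\<dots> = X ** A ** Y"
    by (metis Y2 Y4 matrix_mul_assoc)
  finally show ?thesis
    using \<open>X = X ** A ** Y\<close> by simp
qed

lemma moore_penrose_pinv: "moore_penrose A (pinv A)"
  for A :: "real^'n^'m"
proof -
  have "pinv A = (THE X. moore_penrose A X)"
    unfolding pinv_def moore_penrose_def ..
  also have "\<dots> = matrix (min_norm_lsq A)"
    using moore_penrose_min_norm_lsq moore_penrose_unique by blast
  finally show ?thesis
    using moore_penrose_min_norm_lsq by simp
qed

lemma mult_pinv_mult: "A *v (pinv A *v (A *v z)) = A *v z"
  for A :: "real^'n^'m"
proof -
  have "A ** pinv A ** A = A"
    using moore_penrose_pinv[of A] by (simp add: moore_penrose_def)
  then show ?thesis
    by (metis matrix_vector_mul_assoc)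
qed

section \<open>Rank of lists of difference vectors\<close>

lemma full_col_rank_snoc:
  fixes cols :: "(real^'n) list"
  assumes "full_col_rank cols" and "\<And>v. v \<in> set cols \<Longrightarrow> inner v e = 0" and "inner d e \<noteq> 0"
  shows "full_col_rank (cols @ [d])"
proof -
  have "d \<notin> span (set cols)"
  proof
    assume "d \<in> span (set cols)"
    then have "orthogonal e d"
      by (rule orthogonal_to_span) (simp add: assms(2) orthogonal_def inner_commute)
    with assms(3) show False
      by (simp add: orthogonal_def inner_commute)
  qed
  with assms(1) show ?thesis
    by (simp add: full_col_rank_def dim_insert)
qed

lemma span_differences_to_last_eq_span_consecutive_differences:
  fixes y :: "nat \<Rightarrow> 'a::real_vector"
  shows "span ((\<lambda>j. y j - y k) ` {s..<k}) = span ((\<lambda>j. y j - y (Suc j)) ` {s..<k})"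
proof (rule span_eq[THEN iffD2], intro conjI subsetI)
  fix v assume "v \<in> (\<lambda>j. y j - y k) ` {s..<k}"
  then obtain j where j: "s \<le> j" "j < k" and v: "v = y j - y k"
    by auto
  have "(\<Sum>i = j..<k. y i - y (Suc i)) = (\<Sum>i = j..<k. (- y) (Suc i) - (- y) i)"
    by simp
  also have "\<dots> = (- y) k - (- y) j"
    using j by (intro sum_Suc_diff') simp
  finally have v_sum: "v = (\<Sum>i = j..<k. y i - y (Suc i))"
    by (simp add: v)
  have "y i - y (Suc i) \<in> span ((\<lambda>j. y j - y (Suc j)) ` {s..<k})" if "i \<in> {j..<k}" for i
    using j that by (intro span_base) auto
  then show "v \<in> span ((\<lambda>j. y j - y (Suc j)) ` {s..<k})"
    unfolding v_sum by (rule span_sum)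
next
  let ?D = "span ((\<lambda>j. y j - y k) ` {s..<k})"
  fix v assume "v \<in> (\<lambda>j. y j - y (Suc j)) ` {s..<k}"
  then obtain j where j: "s \<le> j" "j < k" and v: "v = y j - y (Suc j)"
    by auto
  have "y (Suc j) - y k \<in> ?D"
    using j by (cases "Suc j = k") (auto intro: span_base span_zero)
  moreover have "y j - y k \<in> ?D"
    using j by (auto intro: span_base)
  ultimately have "(y j - y k) - (y (Suc j) - y k) \<in> ?D"
    by (rule span_diff[rotated])
  then show "v \<in> ?D"
    by (simp add: v)
qed

lemma full_col_rank_differences_to_last:
  fixes y :: "nat \<Rightarrow> real^'n"
  assumes "s \<le> k"
    and orth: "\<And>j p. s \<le> j \<Longrightarrow> j \<le> p \<Longrightarrow> p \<le> k \<Longrightarrow> inner (y j - y p) (y p - c) = 0"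
    and moves: "\<And>p. s \<le> p \<Longrightarrow> p < k \<Longrightarrow> y (Suc p) \<noteq> y p"
  shows "full_col_rank (map (\<lambda>j. y j - y k) [s..<k])"
proof -
  have "full_col_rank (map (\<lambda>j. y j - y (Suc j)) [s..<p])" if "s \<le> p" "p \<le> k" for p
    using that
  proof (induction p rule: dec_induct)
    case base
    show ?case
      by (simp add: full_col_rank_def)
  next
    case (step p)
    have "inner (y j - y (Suc j)) (y p - c) = 0" if "s \<le> j" "j < p" for j
      using orth[of j p] orth[of "Suc j" p] that step.prems
      by (simp add: inner_diff_left)
    moreover have "inner (y p - y (Suc p)) (y p - c) \<noteq> 0"
    proof -
      have "inner (y p - y (Suc p)) (y p - c) =
          inner (y p - y (Suc p)) (y p - y (Suc p)) + inner (y p - y (Suc p)) (y (Suc p) - c)"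
        by (simp add: inner_diff_right)
      also have "\<dots> = inner (y p - y (Suc p)) (y p - y (Suc p))"
        using orth[of p "Suc p"] step by simp
      finally show ?thesis
        using moves[of p] step by simp
    qed
    ultimately show ?case
      using step by (auto intro!: full_col_rank_snoc)
  qed
  from this[of k] \<open>s \<le> k\<close> show ?thesis
    by (simp add: full_col_rank_def span_differences_to_last_eq_span_consecutive_differences)
qed

section \<open>Projection onto affine hulls of past iterates\<close>

lemma arg_min_dist_affine_orthogonal:
  fixes c :: "'a::euclidean_space"
  assumes min: "is_arg_min (\<lambda>z. (norm (z - c))\<^sup>2) (\<lambda>z. z \<in> P) x"
    and "affine P" and "y \<in> P" and "y' \<in> P"
  shows "inner (y - y') (x - c) = 0"
proof -
  have x: "x \<in> P" and closest: "\<forall>z\<in>P. dist c x \<le> dist c z"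
    using min by (auto simp: is_arg_min_def dist_norm norm_minus_commute not_less
        simp flip: abs_le_square_iff)
  have nonneg: "inner (z - x) (x - c) \<ge> 0" if "z \<in> P" for z
    using any_closest_point_dot[OF affine_imp_convex[OF \<open>affine P\<close>]
        affine_closed[OF \<open>affine P\<close>] x that closest]
    by (simp add: inner_commute inner_diff_left)
  have "inner (z - x) (x - c) = 0" if "z \<in> P" for z
  proof -
    \<comment> \<open>the reflection of z in x also lies in the affine set P\<close>
    let ?z' = "(1 - (-1)) *\<^sub>R x + (-1) *\<^sub>R z"
    have "?z' \<in> P"
      using \<open>affine P\<close> x that unfolding affine_alt by blast
    have "?z' - x = - (z - x)"
      by (simp add: algebra_simps scaleR_2)
    then have "inner (?z' - x) (x - c) = - inner (z - x) (x - c)"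
      by (simp only: inner_minus_left)
    moreover have "inner (?z' - x) (x - c) \<ge> 0"
      using \<open>?z' \<in> P\<close> by (rule nonneg)
    moreover have "inner (z - x) (x - c) \<ge> 0"
      using that by (rule nonneg)
    ultimately show ?thesis
      by linarith
  qed
  from this[OF \<open>y \<in> P\<close>] this[OF \<open>y' \<in> P\<close>] show ?thesis
    by (simp add: inner_diff_left)
qed

lemma inner_sdir_error:
  fixes A :: "real^'n^'m" and S :: "real^'q^'m"
  assumes "A *v c = b"
  shows "inner (sdir A b S z) (z - c) = (norm (transpose S *v (A *v z - b)))\<^sup>2"
proof -
  let ?r = "A *v z - b"
  have "inner (sdir A b S z) (z - c) = inner ((S ** transpose S) *v ?r) (A *v (z - c))"
    unfolding sdir_def by (rule inner_transpose_mult)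
  also have "(S ** transpose S) *v ?r = S *v (transpose S *v ?r)"
    by (simp add: matrix_vector_mul_assoc)
  also have "A *v (z - c) = ?r"
    using assms by (simp add: matrix_vector_mult_diff_distrib)
  also have "inner (S *v (transpose S *v ?r)) ?r = inner (transpose S *v ?r) (transpose S *v ?r)"
    by (rule inner_mult_transpose)
  finally show ?thesis
    by (simp add: power2_norm_eq_inner)
qed

locale projection_iteration =
  fixes A :: "real^'n^'m" and b :: "real^'m" and S :: "nat \<Rightarrow> real^'q^'m"
    and l :: nat and x :: "nat \<Rightarrow> real^'n" and c :: "real^'n"
  assumes l_pos: "l > 0"
    and solution: "A *v c = b"
    and recursion: "\<And>i. is_arg_min (\<lambda>z. (norm (z - c))\<^sup>2) (\<lambda>z. z \<in> Pi_set A b S l x i) (x (Suc i))"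
begin

lemma iterate_in_Pi_set: "jidx l i \<le> j \<Longrightarrow> j \<le> i \<Longrightarrow> x j \<in> Pi_set A b S l x i"
  unfolding Pi_set_def by (rule hull_inc) auto

lemma sdir_step_in_Pi_set: "x i - sdir A b (S i) (x i) \<in> Pi_set A b S l x i"
  unfolding Pi_set_def by (rule hull_inc) auto

lemma next_iterate_in_Pi_set: "x (Suc i) \<in> Pi_set A b S l x i"
  using recursion[of i] by (simp add: is_arg_min_def)

lemma Pi_set_orthogonal_next_error:
  assumes "y \<in> Pi_set A b S l x i" and "y' \<in> Pi_set A b S l x i"
  shows "inner (y - y') (x (Suc i) - c) = 0"
  by (rule arg_min_dist_affine_orthogonal[OF recursion _ assms]) (simp add: Pi_set_def)

lemma window_orthogonal:
  assumes "jidx l k \<le> j" and "j \<le> p" and "p \<le> k"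
  shows "inner (x j - x p) (x p - c) = 0"
proof (cases "j = p")
  case False
  then obtain q where p: "p = Suc q" and "j \<le> q"
    using assms(2) by (cases p) auto
  have "jidx l q \<le> jidx l k"
    using p assms(3) by (simp add: jidx_def)
  then have "x j \<in> Pi_set A b S l x q"
    using assms(1) \<open>j \<le> q\<close> by (intro iterate_in_Pi_set) auto
  from Pi_set_orthogonal_next_error[OF this next_iterate_in_Pi_set] show ?thesis
    by (simp add: p)
qed simp

lemma iterate_moves:
  assumes "transpose (S i) *v (A *v x i - b) \<noteq> 0"
  shows "x (Suc i) \<noteq> x i"
proof
  assume stuck: "x (Suc i) = x i"
  have "jidx l i \<le> i"
    using l_pos by (simp add: jidx_def)
  then have "inner (x i - (x i - sdir A b (S i) (x i))) (x (Suc i) - c) = 0"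
    by (intro Pi_set_orthogonal_next_error iterate_in_Pi_set sdir_step_in_Pi_set) auto
  then have "inner (sdir A b (S i) (x i)) (x i - c) = 0"
    by (simp add: stuck)
  with assms show False
    by (simp add: inner_sdir_error[OF solution])
qed

lemma full_col_rank_Mcols:
  assumes "\<And>i. i \<le> k \<Longrightarrow> transpose (S i) *v (A *v x i - b) \<noteq> 0"
  shows "full_col_rank (Mcols A b S l x k)"
  unfolding Mcols_def
proof (rule full_col_rank_snoc)
  have "jidx l k \<le> k"
    using l_pos by (simp add: jidx_def)
  moreover have "x (Suc p) \<noteq> x p" if "p < k" for p
    using that by (intro iterate_moves assms) simp
  ultimately show "full_col_rank (map (\<lambda>j. x j - x k) [jidx l k..<k])"
    by (intro full_col_rank_differences_to_last[where c = c] window_orthogonal) auto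
  show "inner v (x k - c) = 0" if "v \<in> set (map (\<lambda>j. x j - x k) [jidx l k..<k])" for v
    using that by (auto intro: window_orthogonal)
  show "inner (- sdir A b (S k) (x k)) (x k - c) \<noteq> 0"
    using assms[of k] by (simp add: inner_sdir_error[OF solution])
qed

end

theorem proposition3p1:
  fixes A :: "real^'n^'m" and b :: "real^'m" and l :: nat
    and S :: "nat \<Rightarrow> real^'q^'m" and x :: "nat \<Rightarrow> real^'n" and k :: nat
  assumes consistent: "\<exists>z. A *v z = b"
    and l_pos: "l > 0"
    and x0_range: "x 0 \<in> range (\<lambda>y. transpose A *v y)"
    and recursion: "\<And>i. is_arg_min (\<lambda>z. (norm (z - pinv A *v b))\<^sup>2)
                              (\<lambda>z. z \<in> Pi_set A b S l x i) (x (Suc i))"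
    and nonzero: "\<And>i. i \<le> k \<Longrightarrow> transpose (S i) *v (A *v x i - b) \<noteq> 0"
  shows "full_col_rank (Mcols A b S l x k)"
proof -
  obtain z where "A *v z = b"
    using consistent by blast
  then have "A *v (pinv A *v b) = b"
    using mult_pinv_mult by metis
  then interpret projection_iteration A b S l x "pinv A *v b"
    using l_pos recursion by unfold_locales
  show ?thesis
    using nonzero by (rule full_col_rank_Mcols)
qed

end
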